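(* Let $G=(V,E)$ be an infinite, locally finite, connected graph with bounded Laplacian $\Delta_{bd}$. For any bounded function $u_0:V\to\mathbf{R}$, the bounded solution $u:V\times[0,\infty)\to\mathbf{R}$ to $$\Delta_{bd}u(x,t)+\frac{\partial u}{\partial t}(x,t)=0\ \text{ for all }x\in V,\ t>0,\qquad u(x,0)=u_0(x)\ \text{ for all }x\in V$$ is unique.
   Context: For a vertex $x$, $m(x)$ denotes its valence (number of edges at $x$) and $y\sim x$ means that $x,y$ are joined by an edge. The bounded Laplacian is $\Delta_{bd}f(x)=f(x)-\frac{1}{m(x)}\sum_{y\sim x}f(y)$, acting in the variable $x$ on functions of $(x,t)$. Solutions are, for each vertex, continuous in $t\in[0,\infty)$ and $C^1$ in $t\in(0,\infty)$; bounded means bounded on $V\times[0,\infty)$. *)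

theory Defs
  imports "HOL-Analysis.Analysis"
begin

text \<open>Graphs are simple and undirected: an edge is a two-element set of vertices.\<close>

definition simple_graph :: "'a set \<Rightarrow> 'a set set \<Rightarrow> bool" where
  "simple_graph V E \<longleftrightarrow> (\<forall>e\<in>E. e \<subseteq> V \<and> card e = 2)"

definition adjacent :: "'a set set \<Rightarrow> 'a \<Rightarrow> 'a \<Rightarrow> bool" where
  "adjacent E x y \<longleftrightarrow> {x, y} \<in> E"

definition edges_at :: "'a set set \<Rightarrow> 'a \<Rightarrow> 'a set set" where
  "edges_at E x = {e \<in> E. x \<in> e}"

definition valence :: "'a set set \<Rightarrow> 'a \<Rightarrow> nat" where
  "valence E x = card (edges_at E x)"

definition locally_finite_graph :: "'a set \<Rightarrow> 'a set set \<Rightarrow> bool" where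
  "locally_finite_graph V E \<longleftrightarrow> (\<forall>x\<in>V. finite (edges_at E x))"

definition connected_graph :: "'a set \<Rightarrow> 'a set set \<Rightarrow> bool" where
  "connected_graph V E \<longleftrightarrow> (\<forall>x\<in>V. \<forall>y\<in>V. (adjacent E)\<^sup>*\<^sup>* x y)"

definition bounded_laplacian :: "'a set set \<Rightarrow> ('a \<Rightarrow> real) \<Rightarrow> 'a \<Rightarrow> real" where
  "bounded_laplacian E f x =
     f x - 1 / real (valence E x) * (\<Sum>y | adjacent E x y. f y)"

text \<open>
  A function on \<open>V \<times> [0, \<infinity>)\<close> is represented by a total function of which only the values at
  \<open>x \<in> V\<close> and \<open>t \<ge> 0\<close> matter.
\<close>

definition heat_solution ::
  "'a set \<Rightarrow> 'a set set \<Rightarrow> ('a \<Rightarrow> real) \<Rightarrow> ('a \<Rightarrow> real \<Rightarrow> real) \<Rightarrow> bool" where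
  "heat_solution V E u0 u \<longleftrightarrow>
     (\<forall>x\<in>V. continuous_on {0..} (u x) \<and> u x C1_differentiable_on {0<..}) \<and>
     (\<forall>x\<in>V. \<forall>t>0. bounded_laplacian E (\<lambda>y. u y t) x + deriv (u x) t = 0) \<and>
     (\<forall>x\<in>V. u x 0 = u0 x)"

definition bounded_heat_solution ::
  "'a set \<Rightarrow> 'a set set \<Rightarrow> ('a \<Rightarrow> real) \<Rightarrow> ('a \<Rightarrow> real \<Rightarrow> real) \<Rightarrow> bool" where
  "bounded_heat_solution V E u0 u \<longleftrightarrow>
     heat_solution V E u0 u \<and> bounded ((\<lambda>(x, t). u x t) ` (V \<times> {0..}))"

end

theory Submission
  imports Defs
begin

text \<open>
  Let \<open>w\<close> be the difference of two solutions, with \<open>\<bar>w\<bar> \<le> K\<close>. Since \<open>\<Delta>\<^sub>b\<^sub>d\<close> has operator norm at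
  most 2 on bounded functions, integrating \<open>\<bar>\<partial>w/\<partial>t\<bar> \<le> 2 sup \<bar>w(\<cdot>, t)\<bar>\<close> from \<open>w(\<cdot>, 0) = 0\<close> improves
  a bound \<open>K (2t)\<^sup>n / n!\<close> to \<open>K (2t)\<^sup>n\<^sup>+\<^sup>1 / (n+1)!\<close>; letting \<open>n\<close> tend to infinity gives \<open>w = 0\<close>.
\<close>

lemma inj_on_edge_to: "inj_on (\<lambda>y. {x, y}) S"
  by (auto intro!: inj_onI simp: doubleton_eq_iff)

lemma edge_to_image_subset: "(\<lambda>y. {x, y}) ` {y. adjacent E x y} \<subseteq> edges_at E x"
  by (auto simp: adjacent_def edges_at_def)

text \<open>The map sending \<open>y\<close> to \<open>{x, y}\<close> injects the neighbours of
  \<open>x\<close> into the edges at \<open>x\<close>; finiteness of the target makes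
  \<open>card\<close> monotone along it.\<close>

lemma card_neighbours_le_valence:
  assumes "finite (edges_at E x)"
  shows "card {y. adjacent E x y} \<le> valence E x"
  unfolding valence_def
  using card_inj_on_le[OF inj_on_edge_to edge_to_image_subset assms] .

lemma bounded_laplacian_diff:
  "bounded_laplacian E (\<lambda>y. f y - g y) x = bounded_laplacian E f x - bounded_laplacian E g x"
  by (simp add: bounded_laplacian_def sum_subtractf algebra_simps diff_divide_distrib)

text \<open>An average over neighbours is at most \<open>K\<close> in absolute value, and so is
  \<open>f x\<close>, so their difference is at most \<open>2 * K\<close>. Edges lie inside
  \<open>V\<close>, so the bound on \<open>V\<close> covers all neighbours.\<close>

lemma abs_bounded_laplacian_le:
  assumes V: "simple_graph V E" and "x \<in> V" and fin: "finite (edges_at E x)"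
    and f: "\<And>y. y \<in> V \<Longrightarrow> \<bar>f y\<bar> \<le> K"
  shows "\<bar>bounded_laplacian E f x\<bar> \<le> 2 * K"
proof -
  let ?N = "{y. adjacent E x y}"
  have K: "0 \<le> K"
    using f[OF \<open>x \<in> V\<close>] by linarith
  have "\<bar>\<Sum>y\<in>?N. f y\<bar> \<le> (\<Sum>y\<in>?N. \<bar>f y\<bar>)"
    by (rule sum_abs)
  also have "\<dots> \<le> real (card ?N) * K"
    using V f by (intro sum_bounded_above) (auto simp: simple_graph_def adjacent_def)
  also have "\<dots> \<le> real (valence E x) * K"
    using card_neighbours_le_valence[OF fin] K by (intro mult_right_mono) auto
  finally have "\<bar>1 / real (valence E x) * (\<Sum>y\<in>?N. f y)\<bar> \<le> K"
    \<comment> \<open>At valence 0 the convention \<open>1 / 0 = 0\<close> makes the average vanish,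
      and \<open>0 \<le> K\<close> suffices.\<close>
    using K by (cases "valence E x = 0") (auto simp: abs_mult field_simps)
  then show ?thesis
    using f[OF \<open>x \<in> V\<close>] unfolding bounded_laplacian_def by linarith
qed

text \<open>The \<open>C1\<close> condition makes \<open>deriv\<close> a genuine derivative, so the
  heat equation can be solved for it.\<close>

lemma heat_solution_has_derivative:
  assumes "heat_solution V E u0 u" and "x \<in> V" and "t > 0"
  shows "(u x has_real_derivative - bounded_laplacian E (\<lambda>y. u y t) x) (at t)"
proof -
  have "u x differentiable at t"
    using assms by (auto simp: heat_solution_def C1_differentiable_on_eq)
  then have "(u x has_real_derivative deriv (u x) t) (at t)"
    by (simp add: DERIV_deriv_iff_real_differentiable)
  moreover have "deriv (u x) t = - bounded_laplacian E (\<lambda>y. u y t) x"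
    using assms by (auto simp: heat_solution_def eq_neg_iff_add_eq_0 add.commute)
  ultimately show ?thesis by simp
qed

text \<open>The induction keeps \<open>x\<close> and \<open>t\<close> arbitrary, since the
  derivative at \<open>x\<close> involves the neighbours of \<open>x\<close> at all earlier
  times.\<close>

lemma heat_solution_diff_power_bound:
  assumes V: "simple_graph V E" "locally_finite_graph V E"
    and u: "heat_solution V E u0 u" and v: "heat_solution V E u0 v"
    and K: "\<And>x t. \<lbrakk>x \<in> V; t \<ge> 0\<rbrakk> \<Longrightarrow> \<bar>u x t - v x t\<bar> \<le> K"
    and "x \<in> V" and "t \<ge> 0"
  shows "\<bar>u x t - v x t\<bar> \<le> K * ((2 * t) ^ n / fact n)"
  using \<open>x \<in> V\<close> \<open>t \<ge> 0\<close>
proof (induction n arbitrary: x t)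
  case 0
  then show ?case using K by simp
next
  case (Suc n)
  show ?case
  proof (cases "t = 0")
    case True
    then show ?thesis using u v Suc.prems by (simp add: heat_solution_def)
  next
    case False
    \<comment> \<open>\<open>\<phi>\<close> is the bound claimed for \<open>Suc n\<close>; its
      derivative \<open>\<phi>'\<close> is exactly twice the bound for \<open>n\<close>, the 2
      coming from the norm of the Laplacian.\<close>
    define \<phi> where "\<phi> s = K * ((2 * s) ^ Suc n / fact (Suc n))" for s :: real
    define \<phi>' where "\<phi>' s = 2 * (K * ((2 * s) ^ n / fact n))" for s :: real
    let ?w = "\<lambda>s. u x s - v x s"
    let ?L = "\<lambda>s. bounded_laplacian E (\<lambda>y. u y s - v y s) x"
    have "norm (?w t - ?w 0) \<le> \<phi> t - \<phi> 0"
    \<comment> \<open>This form of the mean value inequality asks for derivatives only in the open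
      interval, matching an equation that holds only for positive times; at 0 continuity is
      enough.\<close>
    proof (rule differentiable_bound_general)
      show "0 < t" using False Suc.prems by simp
      show "continuous_on {0..t} ?w"
        using u v \<open>x \<in> V\<close>
        by (intro continuous_on_diff)
          (auto simp: heat_solution_def intro: continuous_on_subset[of "{0..}"])
      show "continuous_on {0..t} \<phi>"
        unfolding \<phi>_def by (intro continuous_intros) auto
      show "(?w has_vector_derivative - ?L s) (at s)" if "0 < s" for s
        unfolding has_real_derivative_iff_has_vector_derivative[symmetric] bounded_laplacian_diff
        using heat_solution_has_derivative[OF u \<open>x \<in> V\<close> that]
          heat_solution_has_derivative[OF v \<open>x \<in> V\<close> that]
        by (auto intro!: derivative_eq_intros)
      show "(\<phi> has_vector_derivative \<phi>' s) (at s)" for s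
        unfolding has_real_derivative_iff_has_vector_derivative[symmetric] \<phi>_def \<phi>'_def
        by (rule derivative_eq_intros DERIV_power_Suc refl)+
          (simp_all add: power_mult_distrib, simp add: field_simps)
      show "norm (- ?L s) \<le> \<phi>' s" if "0 < s" for s
        unfolding \<phi>'_def real_norm_def abs_minus_cancel
      proof (rule abs_bounded_laplacian_le[OF V(1) \<open>x \<in> V\<close>])
        show "finite (edges_at E x)"
          using V(2) \<open>x \<in> V\<close> by (simp add: locally_finite_graph_def)
      qed (use Suc.IH that in auto)
    qed
    moreover have "?w 0 = 0"
      using u v \<open>x \<in> V\<close> by (simp add: heat_solution_def)
    \<comment> \<open>Here \<open>\<phi> 0 = 0\<close> because the exponent \<open>Suc n\<close> is
      positive.\<close>
    ultimately show ?thesis by (simp add: \<phi>_def)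
  qed
qed

theorem corollary3p6p1:
  fixes V :: "'a set" and E :: "'a set set"
    and u0 :: "'a \<Rightarrow> real" and u v :: "'a \<Rightarrow> real \<Rightarrow> real"
  assumes "simple_graph V E" and "infinite V"
    and "locally_finite_graph V E" and "connected_graph V E"
    and "bounded (u0 ` V)"
    and "bounded_heat_solution V E u0 u"
    and "bounded_heat_solution V E u0 v"
  shows "\<forall>x\<in>V. \<forall>t\<ge>0. u x t = v x t"
proof (intro ballI allI impI)
  fix x t assume x: "x \<in> V" and t: "0 \<le> (t::real)"
  have sol: "heat_solution V E u0 u" "heat_solution V E u0 v"
    using assms by (auto simp: bounded_heat_solution_def)
  obtain A where A: "\<And>x t. x \<in> V \<Longrightarrow> t \<ge> 0 \<Longrightarrow> \<bar>u x t\<bar> \<le> A"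
    using assms(6) by (fastforce simp: bounded_heat_solution_def bounded_iff)
  obtain B where B: "\<And>x t. x \<in> V \<Longrightarrow> t \<ge> 0 \<Longrightarrow> \<bar>v x t\<bar> \<le> B"
    using assms(7) by (fastforce simp: bounded_heat_solution_def bounded_iff)
  have "\<bar>u x t - v x t\<bar> \<le> A + B" if "x \<in> V" "t \<ge> 0" for x t
    using A[OF that] B[OF that] by linarith
  then have bound: "\<bar>u x t - v x t\<bar> \<le> (A + B) * ((2 * t) ^ n / fact n)" for n
    using heat_solution_diff_power_bound[OF assms(1,3) sol _ x t] by blast
  \<comment> \<open>These are the terms of the convergent exponential series at
    \<open>2 * t\<close>, with \<open>t\<close> fixed.\<close>
  have "(\<lambda>n. (2 * t) ^ n / fact n) \<longlonglongrightarrow> 0"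
    using summable_LIMSEQ_zero[OF summable_exp[of "2 * t"]] by (simp add: divide_inverse mult.commute)
  from tendsto_mult_right_zero[OF this, of "A + B"] have "\<bar>u x t - v x t\<bar> \<le> 0"
    by (rule LIMSEQ_le_const) (use bound in auto)
  then show "u x t = v x t" by simp
qed

end
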